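(* For all $p,q_0,q_1\in\mathbb{P}$: if $p$ is prime and $p\mid q_0\cdot q_1$, then $p\mid q_0$ or $p\mid q_1$.
   Context: $\mathbb{P}=\{1,2,3,\dots\}$ (positive integers represented in binary, with constructors $1$, $p\mapsto 2p$, $p\mapsto 2p+1$). Divisibility on $\mathbb{P}$: $p\mid q$ means $\gcd(p,q)=p$, where $\gcd$ is defined recursively (Stein's algorithm) by $\gcd(1,p)=1$, $\gcd(2p,1)=1$, $\gcd(2p,2q)=2\gcd(p,q)$, $\gcd(2p,2q+1)=\gcd(p,2q+1)$, $\gcd(2p+1,1)=1$, $\gcd(2p+1,2q)=\gcd(2p+1,q)$, and $\gcd(2p+1,2q+1)$ equals $\gcd(2p+1,q-p)$ if $p<q$, $\gcd(p-q,2q+1)$ if $q<p$, and $2p+1$ if $p=q$. Primality on $\mathbb{P}$: $p$ is composed if there is $q\le\lfloor\sqrt p\rfloor$ with $1<q$ and $q\mid p$, where $\lfloor\sqrt p\rfloor$ is the largest $r\in\mathbb{P}$ with $r\cdot r\le p$; $p$ is prime if $p>1$ and $p$ is not composed. The disjunction in the conclusion is a Boolean disjunction of decidable statements. *)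

theory Defs
  imports Main
begin

text \<open>
  The binary positive integers are the library type \<^typ>\<open>num\<close>, with its
  constructors \<^const>\<open>num.One\<close>, \<^const>\<open>num.Bit0\<close> (doubling) and
  \<^const>\<open>num.Bit1\<close> (doubling plus one), and with its library \<open>+\<close>, \<open>*\<close>, \<open>\<le>\<close>, \<open><\<close>.
  It carries no subtraction. The one below is meaningful only for \<open>n < m\<close>, and is only
  used there; otherwise its value is the junk value \<^const>\<open>num.One\<close>.
\<close>

definition num_diff :: "num \<Rightarrow> num \<Rightarrow> num" where
  "num_diff m n = num_of_nat (nat_of_num m - nat_of_num n)"

lemma nat_of_num_diff:
  "n < m \<Longrightarrow> nat_of_num (num_diff m n) = nat_of_num m - nat_of_num n"
  by (simp add: num_diff_def less_num_def num_of_nat_inverse)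

lemma add_num_diff: "n < m \<Longrightarrow> n + num_diff m n = m"
  by (simp add: num_eq_iff nat_of_num_add nat_of_num_diff less_num_def)

function num_gcd :: "num \<Rightarrow> num \<Rightarrow> num" where
  "num_gcd num.One p = num.One"
| "num_gcd (num.Bit0 p) num.One = num.One"
| "num_gcd (num.Bit0 p) (num.Bit0 q) = num.Bit0 (num_gcd p q)"
| "num_gcd (num.Bit0 p) (num.Bit1 q) = num_gcd p (num.Bit1 q)"
| "num_gcd (num.Bit1 p) num.One = num.One"
| "num_gcd (num.Bit1 p) (num.Bit0 q) = num_gcd (num.Bit1 p) q"
| "num_gcd (num.Bit1 p) (num.Bit1 q) =
    (if p < q then num_gcd (num.Bit1 p) (num_diff q p)
     else if q < p then num_gcd (num_diff p q) (num.Bit1 q)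
     else num.Bit1 p)"
  by pat_completeness auto
termination
  by (relation "measure (\<lambda>(p, q). nat_of_num p + nat_of_num q)")
    (auto simp: nat_of_num_diff nat_of_num_pos)

definition num_dvd :: "num \<Rightarrow> num \<Rightarrow> bool" where
  "num_dvd p q \<longleftrightarrow> num_gcd p q = p"

definition num_sqrt :: "num \<Rightarrow> num" where
  "num_sqrt p = (GREATEST r. r * r \<le> p)"

text \<open>The greatest element above always exists, so \<^const>\<open>num_sqrt\<close> is well defined.\<close>

lemma num_sqrt_exists: "\<exists>r::num. r * r \<le> p \<and> (\<forall>s. s * s \<le> p \<longrightarrow> s \<le> r)"
proof -
  have bound: "\<forall>r. r * r \<le> p \<longrightarrow> nat_of_num r < Suc (nat_of_num p)"
  proof (intro allI impI)
    fix r :: num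
    assume r: "r * r \<le> p"
    have "nat_of_num r \<le> nat_of_num r * nat_of_num r"
      by (rule le_square)
    also have "\<dots> \<le> nat_of_num p"
      using r unfolding less_eq_num_def nat_of_num_mult .
    finally show "nat_of_num r < Suc (nat_of_num p)" by (rule le_imp_less_Suc)
  qed
  have "num.One * num.One \<le> p" by simp
  from ex_has_greatest_nat[of "\<lambda>r. r * r \<le> p", OF this bound]
  show ?thesis unfolding less_eq_num_def .
qed

definition num_composed :: "num \<Rightarrow> bool" where
  "num_composed p \<longleftrightarrow> (\<exists>q \<le> num_sqrt p. num.One < q \<and> num_dvd q p)"

definition num_prime :: "num \<Rightarrow> bool" where
  "num_prime p \<longleftrightarrow> num.One < p \<and> \<not> num_composed p"

end

theory Submission
  imports Defs "HOL-Computational_Algebra.Primes"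
begin

text \<open>
  This is Euclid's lemma, and the work lies in recognising the binary notions as the usual ones
  under the order-preserving injection \<^const>\<open>nat_of_num\<close>. Each step of Stein's algorithm
  preserves the greatest common divisor of the natural numbers denoted, so \<^const>\<open>num_gcd\<close>
  computes \<^const>\<open>gcd\<close> (\<open>nat_of_num_gcd\<close>) and \<^const>\<open>num_dvd\<close> is divisibility
  (\<open>num_dvd_iff\<close>). A number that factors nontrivially has a factor greater than 1 and no larger
  than its square root, so searching for divisors only that far loses nothing, and
  \<^const>\<open>num_prime\<close> implies primality (\<open>prime_nat_of_num\<close>). Euclid's lemma for natural numbers, which rests on the
  Bezout identity, then applies.
\<close>

text \<open>
  An odd number is coprime to 2, so factors of 2 in the other argument do not contribute; this
  justifies the steps of Stein's algorithm on arguments of mixed parity.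
\<close>

lemma gcd_double_odd:
  fixes a b :: nat
  assumes "odd b"
  shows "gcd (2 * a) b = gcd a b"
  using assms by (simp add: gcd_mult_left_left_cancel coprime_commute)

text \<open>
  On two odd arguments the algorithm replaces the difference $2(n - m)$ by its half $n - m$.
\<close>

lemma gcd_odd_half_diff:
  fixes m n :: nat
  assumes "m < n"
  shows "gcd (2 * m + 1) (n - m) = gcd (2 * m + 1) (2 * n + 1)"
proof -
  have "gcd (2 * m + 1) (2 * n + 1) = gcd (2 * m + 1) (2 * (n - m))"
    using gcd_add2[of "2 * m + 1" "2 * (n - m)"] assms by (simp add: algebra_simps)
  also have "\<dots> = gcd (2 * m + 1) (n - m)"
    using gcd_double_odd[of "2 * m + 1" "n - m"] by (simp add: gcd.commute)
  finally show ?thesis by simp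
qed

lemma nat_of_num_Bit0: "nat_of_num (num.Bit0 p) = 2 * nat_of_num p"
  and nat_of_num_Bit1: "nat_of_num (num.Bit1 p) = 2 * nat_of_num p + 1"
  by simp_all

lemma nat_of_num_gcd:
  "nat_of_num (num_gcd p q) = gcd (nat_of_num p) (nat_of_num q)"
proof (induction p q rule: num_gcd.induct)
  case (3 p q)
  then show ?case
    by (simp only: num_gcd.simps nat_of_num_Bit0 gcd_mult_distrib_nat)
next
  case (4 p q)
  then show ?case
    by (simp add: nat_of_num_Bit0 nat_of_num_Bit1 gcd_double_odd del: nat_of_num.simps)
next
  case (6 p q)
  then show ?case
    using gcd_double_odd[of "nat_of_num (num.Bit1 p)" "nat_of_num q"]
    by (simp add: nat_of_num_Bit0 nat_of_num_Bit1 gcd.commute del: nat_of_num.simps)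
next
  case (7 p q)
  consider "p < q" | "q < p" | "p = q" using less_linear by blast
  then show ?case
  proof cases
    case 1
    then show ?thesis
      using 7 gcd_odd_half_diff[of "nat_of_num p" "nat_of_num q"]
      by (simp add: nat_of_num_Bit1 nat_of_num_diff less_num_def del: nat_of_num.simps)
  next
    case 2
    then show ?thesis
      using 7 gcd_odd_half_diff[of "nat_of_num q" "nat_of_num p"]
      by (simp add: nat_of_num_Bit1 nat_of_num_diff less_num_def gcd.commute
          del: nat_of_num.simps)
  next
    case 3
    then show ?thesis by simp
  qed
qed simp_all

lemma num_dvd_iff: "num_dvd p q \<longleftrightarrow> nat_of_num p dvd nat_of_num q"
  unfolding num_dvd_def num_eq_iff nat_of_num_gcd
  by (rule gcd_nat.absorb_iff1 [symmetric])

lemma le_num_sqrt: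
  assumes "r * r \<le> p"
  shows "r \<le> num_sqrt p"
proof -
  obtain s where s: "s * s \<le> p" "\<And>t. t * t \<le> p \<Longrightarrow> t \<le> s"
    using num_sqrt_exists by blast
  have "num_sqrt p = s"
    unfolding num_sqrt_def by (rule Greatest_equality) (use s in auto)
  with s assms show ?thesis by simp
qed

text \<open>
  In a factorisation $n = d e$ the smaller factor has square at most $n$; if $d$ is proper and
  greater than $1$, then so is $e$, and either may be the smaller one.
\<close>

lemma nonprime_has_small_divisor:
  fixes n :: nat
  assumes "1 < n" and "\<not> prime n"
  obtains d where "1 < d" "d dvd n" "d * d \<le> n"
proof -
  obtain d where d: "d dvd n" "d \<noteq> 1" "d \<noteq> n"
    using assms by (auto simp: prime_nat_iff)
  then obtain e where n: "n = d * e" by (auto elim: dvdE)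
  have "d \<noteq> 0" "e \<noteq> 0" "e \<noteq> 1"
    using n d(3) assms(1) by (auto intro!: gr0I)
  then have "1 < d" "1 < e"
    using d(2) by linarith+
  show thesis
  proof (cases "d \<le> e")
    case True
    then show ?thesis using that[of d] \<open>1 < d\<close> n by simp
  next
    case False
    then show ?thesis using that[of e] \<open>1 < e\<close> n by simp
  qed
qed

lemma prime_nat_of_num:
  assumes "num_prime p"
  shows "prime (nat_of_num p)"
proof (rule ccontr)
  assume "\<not> prime (nat_of_num p)"
  moreover have "1 < nat_of_num p"
    using assms by (simp add: num_prime_def less_num_def)
  ultimately obtain d where d: "1 < d" "d dvd nat_of_num p" "d * d \<le> nat_of_num p"
    using nonprime_has_small_divisor by blast
  define q where "q = num_of_nat d"
  have q: "nat_of_num q = d"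
    using d(1) by (simp add: q_def num_of_nat_inverse)
  have "q \<le> num_sqrt p"
    using d(3) q by (intro le_num_sqrt) (simp add: less_eq_num_def nat_of_num_mult)
  moreover have "num.One < q"
    using d(1) q by (simp add: less_num_def)
  moreover have "num_dvd q p"
    using d(2) q by (simp add: num_dvd_iff)
  ultimately have "num_composed p"
    unfolding num_composed_def by blast
  with assms show False by (simp add: num_prime_def)
qed

theorem lemma19:
  fixes p q0 q1 :: num
  assumes "num_prime p"
    and "num_dvd p (q0 * q1)"
  shows "num_dvd p q0 \<or> num_dvd p q1"
  using assms prime_nat_of_num[OF assms(1)]
  by (simp add: num_dvd_iff nat_of_num_mult prime_dvd_mult_iff)

end
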